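(* For every integer $n\geq 1$ and all $x,y\in\mathbb{R}$, $$\int_0^1\sum_{k,l,m\in\mathbb{Z}}\big(L_{(2k,l,m)}\phi_n\big)(x,y,t)\,dt=(\sqrt{2})^{n-2},$$ where $\phi_n$ is the $n$-th order $B$-spline on the Heisenberg group $\mathbb{H}$ and $L_{(2k,l,m)}$ denotes left translation by $(2k,l,m)\in\mathbb{H}$.
   Context: The Heisenberg group $\mathbb{H}$ is $\mathbb{R}^3$ with the group law $(x,y,t)(x',y',t')=(x+x',\,y+y',\,t+t'+\tfrac12(x'y-y'x))$, so that $(x,y,t)^{-1}=(-x,-y,-t)$; Haar measure is Lebesgue measure $dx\,dy\,dt$ on $\mathbb{R}^3$. For $f,g\in L^1(\mathbb{H})$, the convolution is $(f*g)(x,y,t)=\int_{\mathbb{H}}f\big((x,y,t)(u,v,s)^{-1}\big)g(u,v,s)\,du\,dv\,ds$. The $B$-splines on $\mathbb{H}$ are $\phi_1=\frac{1}{\sqrt2}\chi_{[0,2]\times[0,1]\times[0,1]}$, where $\chi_E$ denotes the characteristic function of $E$, and, for $n\ge1$, $\phi_{n+1}=\phi_n*\phi_1$ (so $\phi_n$ is the $n$-fold convolution of $\phi_1$ with itself). For $(u,v,s)\in\mathbb{H}$, the left translation operator is $L_{(u,v,s)}f(x,y,t)=f\big((u,v,s)^{-1}(x,y,t)\big)$.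
   Formalization: For n = 1 the identity is stated only when x is not an even integer and y is not an integer, since at those points the closed boxes overlap and the left side is 2/√2 or 4/√2; for n ≥ 2 it holds for all real x, y. *)

theory Defs
  imports "HOL-Analysis.Analysis"
begin

text \<open>The Heisenberg group, realised on \<open>\<real>\<^sup>3\<close>; its Haar measure is \<^term>\<open>lborel\<close>.\<close>

type_synonym heis = "real \<times> real \<times> real"

fun heis_mult :: "heis \<Rightarrow> heis \<Rightarrow> heis" where
  "heis_mult (x, y, t) (x', y', t') = (x + x', y + y', t + t' + (x' * y - y' * x) / 2)"

fun heis_inv :: "heis \<Rightarrow> heis" where
  "heis_inv (x, y, t) = (- x, - y, - t)"

definition heis_conv :: "(heis \<Rightarrow> real) \<Rightarrow> (heis \<Rightarrow> real) \<Rightarrow> heis \<Rightarrow> real" where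
  "heis_conv f g p = (LINT q|lborel. f (heis_mult p (heis_inv q)) * g q)"

definition heis_trans :: "heis \<Rightarrow> (heis \<Rightarrow> real) \<Rightarrow> heis \<Rightarrow> real" where
  "heis_trans q f p = f (heis_mult (heis_inv q) p)"

text \<open>Splines are indexed from 1; the value at index 0 is a dummy.\<close>

fun heis_bspline :: "nat \<Rightarrow> heis \<Rightarrow> real" where
  "heis_bspline 0 = (\<lambda>_. 0)"
| "heis_bspline (Suc 0) = (\<lambda>p. 1 / sqrt 2 * indicator ({0..2} \<times> {0..1} \<times> {0..1}) p)"
| "heis_bspline (Suc (Suc n)) = heis_conv (heis_bspline (Suc n)) (heis_bspline (Suc 0))"

end

theory Submission imports Defs begin

text \<open>
  Write \<open>G\<^sub>n(a, b) = \<integral> \<phi>\<^sub>n(a, b, t) dt\<close>. The group law shears the central coordinate only by a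
  quantity that does not depend on it, so integrating over \<open>t \<in> [0, 1]\<close> and summing over the central
  translates \<open>m\<close> turns the left-hand side into \<open>H\<^sub>n(x, y) = \<Sum>\<^bsub>k,l\<^esub> G\<^sub>n(x - 2k, y - l)\<close>. For the same
  reason \<open>G\<^sub>n\<^sub>+\<^sub>1\<close> is an ordinary planar convolution, whence \<open>H\<^sub>n\<^sub>+\<^sub>1(x, y)\<close> is the average
  \<open>\<integral> \<phi>\<^sub>1(u, v, s) H\<^sub>n(x - u, y - v)\<close>. Since the translates of \<open>[0, 2] \<times> [0, 1]\<close> tile the plane,
  \<open>H\<^sub>1\<close> is almost everywhere \<open>1 / \<surd>2\<close>, and each further convolution multiplies by \<open>\<integral> \<phi>\<^sub>1 = \<surd>2\<close>.
\<close>

declare heis_bspline.simps(2) [simp del]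

section \<open>Measurability of the group operations\<close>

lemma heis_mult_measurable [measurable]:
  assumes [measurable]: "f \<in> borel_measurable M" "g \<in> borel_measurable M"
  shows "(\<lambda>x. heis_mult (f x) (g x)) \<in> borel_measurable M"
proof -
  have "continuous_on UNIV (\<lambda>p. (fst (fst p) + fst (snd p), fst (snd (fst p)) + fst (snd (snd p)),
      snd (snd (fst p)) + snd (snd (snd p)) +
      (fst (snd p) * fst (snd (fst p)) - fst (snd (snd p)) * fst (fst p)) / (2::real)))"
    by (intro continuous_intros) auto
  moreover have "(\<lambda>p. heis_mult (fst p) (snd p)) = (\<lambda>p. (fst (fst p) + fst (snd p), fst (snd (fst p)) + fst (snd (snd p)),
      snd (snd (fst p)) + snd (snd (snd p)) +
      (fst (snd p) * fst (snd (fst p)) - fst (snd (snd p)) * fst (fst p)) / 2))"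
    by (auto simp: fun_eq_iff)
  ultimately have "(\<lambda>p. heis_mult (fst p) (snd p)) \<in> borel_measurable borel"
    by (simp add: borel_measurable_continuous_onI)
  from measurable_compose[OF borel_measurable_Pair[OF assms] this] show ?thesis by simp
qed

lemma heis_inv_measurable [measurable]:
  assumes [measurable]: "f \<in> borel_measurable M"
  shows "(\<lambda>x. heis_inv (f x)) \<in> borel_measurable M"
proof -
  have "heis_inv = (\<lambda>p. - p)" by (auto simp: fun_eq_iff)
  then show ?thesis using borel_measurable_uminus[OF assms] by simp
qed

section \<open>Mass of the first spline\<close>

lemma emeasure_bspline_box:
  "emeasure lborel ({0..2::real} \<times> {0..1::real} \<times> {0..1::real}) = 2"
proof -
  have "emeasure (lborel \<Otimes>\<^sub>M lborel) ({0..1::real} \<times> {0..1::real}) = 1"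
    by (subst lborel.emeasure_pair_measure_Times) auto
  then have *: "emeasure lborel ({0..1::real} \<times> {0..1::real}) = 1" by (simp add: lborel_prod)
  have "emeasure (lborel \<Otimes>\<^sub>M lborel) ({0..2::real} \<times> ({0..1::real} \<times> {0..1::real})) = 2"
    by (subst lborel.emeasure_pair_measure_Times) (auto simp: * borel_Times)
  then show ?thesis by (simp add: lborel_prod)
qed

lemma bspline_box_sets: "{0..2::real} \<times> {0..1::real} \<times> {0..1::real} \<in> sets borel"
  by (intro borel_closed closed_Times) auto

lemma bspline_one_measurable: "heis_bspline (Suc 0) \<in> borel_measurable borel"
  using bspline_box_sets by (simp add: heis_bspline.simps(2))

lemma bspline_one_integrable: "integrable lborel (heis_bspline (Suc 0))"
  using bspline_box_sets emeasure_bspline_box by (simp add: heis_bspline.simps(2) integrable_indicator_iff)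

lemma nn_integral_bspline_one:
  "(\<integral>\<^sup>+q. ennreal (heis_bspline (Suc 0) q) \<partial>lborel) = ennreal (sqrt 2)"
proof -
  have "(\<integral>\<^sup>+q. ennreal (heis_bspline (Suc 0) q) \<partial>lborel)
      = (\<integral>\<^sup>+q. ennreal (1 / sqrt 2) * indicator ({0..2::real} \<times> {0..1::real} \<times> {0..1::real}) q \<partial>lborel)"
    by (intro nn_integral_cong) (auto simp: heis_bspline.simps(2) indicator_def)
  also have "\<dots> = ennreal (1 / sqrt 2) * ennreal 2"
    using bspline_box_sets by (simp add: nn_integral_cmult_indicator emeasure_bspline_box)
  also have "\<dots> = ennreal (sqrt 2)"
    by (subst ennreal_mult[symmetric]) (simp_all add: real_div_sqrt)
  finally show ?thesis .
qed

section \<open>Positivity, measurability, bounds and support of the splines\<close>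

lemma bspline_nonneg: "0 \<le> heis_bspline (Suc n) p"
proof (induction n arbitrary: p)
  case 0
  then show ?case by (simp add: heis_bspline.simps(2))
next
  case (Suc n)
  show ?case unfolding heis_bspline.simps(3) heis_conv_def
    by (intro integral_nonneg_AE AE_I2 mult_nonneg_nonneg Suc) (simp add: heis_bspline.simps(2))
qed

lemma bspline_measurable [measurable]: "heis_bspline (Suc n) \<in> borel_measurable borel"
proof (induction n)
  case 0
  then show ?case by (rule bspline_one_measurable)
next
  case (Suc n)
  note [measurable] = Suc bspline_one_measurable
  have "(\<lambda>p. LINT q|lborel. heis_bspline (Suc n) (heis_mult p (heis_inv q)) * heis_bspline (Suc 0) q)
      \<in> borel_measurable lborel"
    by measurable
  then show ?case by (simp add: heis_conv_def[abs_def])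
qed

text \<open>Convolving a bounded function with the integrable \<open>heis_bspline (Suc 0)\<close>
  keeps it bounded. The bound serves to show that the convolution integrand is integrable, with
  majorant \<open>C * heis_bspline (Suc 0) q\<close>.\<close>

lemma bspline_bounded:
  obtains C where "\<And>p. heis_bspline (Suc n) p \<le> C"
proof -
  have "\<exists>C. \<forall>p. heis_bspline (Suc n) p \<le> C"
  proof (induction n)
    case 0
    then show ?case by (auto intro!: exI[of _ 1] simp: heis_bspline.simps(2) indicator_def)
  next
    case (Suc n)
    then obtain C where C: "\<And>p. heis_bspline (Suc n) p \<le> C" by blast
    \<comment> \<open>\<open>integral_mono'\<close> rests on a nonnegative integrable majorant;
      \<open>C\<close> is nonnegative because it dominates a nonnegative spline.\<close>
    have "heis_bspline (Suc (Suc n)) p \<le> (LINT q|lborel. C * heis_bspline (Suc 0) q)" for p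
      unfolding heis_bspline.simps(3) heis_conv_def
      by (intro integral_mono' integrable_mult_right bspline_one_integrable mult_right_mono C
          bspline_nonneg mult_nonneg_nonneg order_trans[OF bspline_nonneg C])
    then show ?case by blast
  qed
  then show thesis using that by blast
qed

text \<open>This is the passage from the Bochner integral in \<open>heis_conv\<close> to nonnegative
  integrals, where Tonelli applies. Integrability is essential to it: a Bochner integral that does
  not exist has the value 0, while the nonnegative one would be infinite.\<close>

lemma bspline_Suc_nn_integral:
  "ennreal (heis_bspline (Suc (Suc n)) p) =
    (\<integral>\<^sup>+q. ennreal (heis_bspline (Suc n) (heis_mult p (heis_inv q))) * ennreal (heis_bspline (Suc 0) q) \<partial>lborel)"
proof -
  note [measurable] = bspline_one_measurable
  obtain C where C: "\<And>p. heis_bspline (Suc n) p \<le> C" using bspline_bounded by blast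
  have "integrable lborel (\<lambda>q. heis_bspline (Suc n) (heis_mult p (heis_inv q)) * heis_bspline (Suc 0) q)"
  proof (rule Bochner_Integration.integrable_bound)
    show "integrable lborel (\<lambda>q. C * heis_bspline (Suc 0) q)"
      by (intro integrable_mult_right bspline_one_integrable)
    show "AE q in lborel. norm (heis_bspline (Suc n) (heis_mult p (heis_inv q)) * heis_bspline (Suc 0) q)
        \<le> norm (C * heis_bspline (Suc 0) q)"
      unfolding norm_mult
      by (intro AE_I2 mult_right_mono) (auto simp: bspline_nonneg intro: order_trans[OF C])
  qed measurable
  then have "ennreal (heis_bspline (Suc (Suc n)) p) =
    (\<integral>\<^sup>+q. ennreal (heis_bspline (Suc n) (heis_mult p (heis_inv q)) * heis_bspline (Suc 0) q) \<partial>lborel)"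
    unfolding heis_bspline.simps(3) heis_conv_def
    by (intro nn_integral_eq_integral[symmetric] AE_I2 mult_nonneg_nonneg bspline_nonneg)
  then show ?thesis by (simp only: ennreal_mult bspline_nonneg)
qed

text \<open>Bounded support makes the lattice sum finite at each point, which later gives
  summability. In the induction step a nonzero value at \<open>p\<close> forces some
  \<open>q\<close> in the box with \<open>heis_mult p (heis_inv q)\<close> in the previous support,
  and this confines \<open>p\<close>.\<close>

lemma bspline_support:
  obtains R where
    "\<And>a b c. heis_bspline (Suc n) (a, b, c) \<noteq> 0 \<Longrightarrow> \<bar>a\<bar> \<le> R \<and> \<bar>b\<bar> \<le> R \<and> \<bar>c\<bar> \<le> R"
proof -
  have "\<exists>R. \<forall>a b c. heis_bspline (Suc n) (a, b, c) \<noteq> 0 \<longrightarrow> \<bar>a\<bar> \<le> R \<and> \<bar>b\<bar> \<le> R \<and> \<bar>c\<bar> \<le> R"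
  proof (induction n)
    case 0
    then show ?case by (auto intro!: exI[of _ 2] simp: heis_bspline.simps(2) indicator_def split: if_splits)
  next
    case (Suc n)
    then obtain R where R: "\<And>a b c. heis_bspline (Suc n) (a, b, c) \<noteq> 0 \<Longrightarrow>
        \<bar>a\<bar> \<le> R \<and> \<bar>b\<bar> \<le> R \<and> \<bar>c\<bar> \<le> R" by blast
    \<comment> \<open>The planar coordinates are at most \<open>R + 2\<close> in absolute value. The
      shear is then at most \<open>3 * (R + 2) / 2\<close>, so the central one is at most
      \<open>R + 1 + 3 * (R + 2) / 2\<close>. As \<open>R\<close> is nonnegative here,
      \<open>3 * R + 10\<close> covers all three.\<close>
    have "\<bar>a\<bar> \<le> 3 * R + 10 \<and> \<bar>b\<bar> \<le> 3 * R + 10 \<and> \<bar>c\<bar> \<le> 3 * R + 10"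
      if nz: "heis_bspline (Suc (Suc n)) (a, b, c) \<noteq> 0" for a b c
    proof -
      have "\<exists>q. heis_bspline (Suc n) (heis_mult (a, b, c) (heis_inv q)) * heis_bspline (Suc 0) q \<noteq> 0"
      proof (rule ccontr)
        assume "\<not> ?thesis"
        then have "heis_bspline (Suc (Suc n)) (a, b, c) = 0"
          unfolding heis_bspline.simps(3) heis_conv_def
          by (intro integral_eq_zero_AE AE_I2) blast
        with nz show False by simp
      qed
      then obtain u v s where 1: "heis_bspline (Suc n) (heis_mult (a, b, c) (heis_inv (u, v, s))) \<noteq> 0"
        and 2: "heis_bspline (Suc 0) (u, v, s) \<noteq> 0"
        by (metis mult_zero_left mult_zero_right prod_cases3)
      from 2 have q: "0 \<le> u" "u \<le> 2" "0 \<le> v" "v \<le> 1" "0 \<le> s" "s \<le> 1"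
        by (auto simp: heis_bspline.simps(2) indicator_def split: if_splits)
      from 1 R[of "a - u" "b - v" "c - s + (v * a - u * b) / 2"]
      have r: "\<bar>a - u\<bar> \<le> R" "\<bar>b - v\<bar> \<le> R" "\<bar>c - s + (v * a - u * b) / 2\<bar> \<le> R"
        by (auto simp: algebra_simps)
      have ab: "\<bar>a\<bar> \<le> R + 2" "\<bar>b\<bar> \<le> R + 2" using r q by linarith+
      have "\<bar>v * a\<bar> \<le> 1 * (R + 2)" "\<bar>u * b\<bar> \<le> 2 * (R + 2)"
        unfolding abs_mult by (intro mult_mono; use q ab in linarith)+
      then show ?thesis using r q ab by (auto simp: abs_le_iff field_simps)
    qed
    then show ?case by blast
  qed
  then show thesis using that by blast
qed

section \<open>Translation, periodization and iterated sums\<close>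

lemma nn_integral_real_shift:
  fixes f :: "real \<Rightarrow> ennreal"
  assumes "f \<in> borel_measurable borel"
  shows "(\<integral>\<^sup>+t. f (t + c) \<partial>lborel) = (\<integral>\<^sup>+t. f t \<partial>lborel)"
  using nn_integral_real_affine[OF assms, of 1 c] by (simp add: add.commute)

text \<open>Substituting \<open>t + m\<close> for \<open>t\<close> moves the translate from
  \<open>f\<close> to the window. The windows \<open>[-m, 1 - m]\<close> cover the line and overlap
  only at integers, a null set.\<close>

lemma nn_integral_periodization:
  fixes f :: "real \<Rightarrow> ennreal"
  assumes [measurable]: "f \<in> borel_measurable borel"
  shows "(\<integral>\<^sup>+m. (\<integral>\<^sup>+t. f (t - of_int m) * indicator {0..1} t \<partial>lborel) \<partial>count_space (UNIV :: int set))
    = (\<integral>\<^sup>+t. f t \<partial>lborel)"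
proof -
  have "(\<integral>\<^sup>+t. f (t - of_int m) * indicator {0..1} t \<partial>lborel)
      = (\<integral>\<^sup>+t. f t * indicator {0..1} (t + of_int m) \<partial>lborel)" for m :: int
    using nn_integral_real_shift[of "\<lambda>t. f (t - of_int m) * indicator {0..1} t" "of_int m"] by simp
  then have "(\<integral>\<^sup>+m. (\<integral>\<^sup>+t. f (t - of_int m) * indicator {0..1} t \<partial>lborel) \<partial>count_space (UNIV :: int set))
      = (\<integral>\<^sup>+t. (\<integral>\<^sup>+m. f t * indicator {0..1} (t + of_int m) \<partial>count_space (UNIV :: int set)) \<partial>lborel)"
    by (simp add: nn_integral_count_space_nn_integral)
  also have "\<dots> = (\<integral>\<^sup>+t. f t \<partial>lborel)"
  proof (rule nn_integral_cong_AE)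
    have "countable (\<int> :: real set)" by (simp add: Ints_def)
    then have "AE t in lborel. (t::real) \<notin> \<int>" by (intro AE_not_in countable_imp_null_set_lborel)
    then show "AE t in lborel. (\<integral>\<^sup>+m. f t * indicator {0..1} (t + of_int m) \<partial>count_space (UNIV :: int set)) = f t"
    proof eventually_elim
      case (elim t)
      have "indicator {0..1} (t + of_int m) = (indicator {- \<lfloor>t\<rfloor>} m :: ennreal)" for m :: int
      proof -
        \<comment> \<open>Away from the integers the closed window acts as a half-open one, so
          exactly one \<open>m\<close> places \<open>t\<close> in it.\<close>
        have "t + of_int m \<noteq> 1"
        proof
          assume "t + of_int m = 1"
          then have "t = of_int (1 - m)" by simp
          with elim show False by (metis Ints_of_int)
        qed
        then have "t + of_int m \<in> {0..1} \<longleftrightarrow> m = - \<lfloor>t\<rfloor>"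
          by (auto simp: less_le) linarith+
        then show ?thesis by (simp add: indicator_def)
      qed
      then show ?case by (simp add: nn_integral_cmult)
    qed
  qed
  finally show ?thesis .
qed

lemma nn_integral_count_space_prod:
  "(\<integral>\<^sup>+i. f i \<partial>count_space (UNIV :: ('a \<times> 'b) set)) =
    (\<integral>\<^sup>+a. \<integral>\<^sup>+b. f (a, b) \<partial>count_space UNIV \<partial>count_space UNIV)"
  by (rule nn_integral_fst_count_space[symmetric])

section \<open>Integrals along the central fibres\<close>

definition bspline_fibre :: "nat \<Rightarrow> real \<Rightarrow> real \<Rightarrow> ennreal" where
  "bspline_fibre n a b = (\<integral>\<^sup>+t. ennreal (heis_bspline n (a, b, t)) \<partial>lborel)"

lemma bspline_fibre_measurable [measurable]:
  assumes [measurable]: "f \<in> borel_measurable M" "g \<in> borel_measurable M"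
  shows "(\<lambda>x. bspline_fibre (Suc n) (f x) (g x)) \<in> borel_measurable M"
proof -
  have "(\<lambda>p. (f (fst p), g (fst p), snd p)) \<in> borel_measurable (M \<Otimes>\<^sub>M lborel)"
    by (intro borel_measurable_Pair) measurable
  then have [measurable]: "(\<lambda>p. heis_bspline (Suc n) (f (fst p), g (fst p), snd p)) \<in> borel_measurable (M \<Otimes>\<^sub>M lborel)"
    by measurable
  have "(\<lambda>(x, t). ennreal (heis_bspline (Suc n) (f x, g x, t))) \<in> borel_measurable (M \<Otimes>\<^sub>M lborel)"
    unfolding case_prod_unfold by measurable
  then show ?thesis unfolding bspline_fibre_def by (rule lborel.borel_measurable_nn_integral)
qed

lemma bspline_fibre_one:
  "bspline_fibre (Suc 0) a b = ennreal (1 / sqrt 2) * indicator ({0..2} \<times> {0..1}) (a, b)"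
proof -
  have "bspline_fibre (Suc 0) a b =
      (\<integral>\<^sup>+t. (ennreal (1 / sqrt 2) * indicator ({0..2} \<times> {0..1}) (a, b)) * indicator {0..1::real} t \<partial>lborel)"
    unfolding bspline_fibre_def by (intro nn_integral_cong) (auto simp: heis_bspline.simps(2) indicator_def)
  also have "\<dots> = ennreal (1 / sqrt 2) * indicator ({0..2} \<times> {0..1}) (a, b)"
    by (subst nn_integral_cmult_indicator) auto
  finally show ?thesis .
qed

text \<open>After Tonelli, \<open>q\<close> is fixed while \<open>t\<close> varies, and right
  multiplication by \<open>heis_inv q\<close> moves \<open>t\<close> by a constant determined by
  \<open>a\<close>, \<open>b\<close> and \<open>q\<close>. Translation invariance erases that
  constant, leaving a commutative planar convolution.\<close>

lemma bspline_fibre_Suc: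
  "bspline_fibre (Suc (Suc n)) a b =
    (\<integral>\<^sup>+q. ennreal (heis_bspline (Suc 0) q) * bspline_fibre (Suc n) (a - fst q) (b - fst (snd q)) \<partial>lborel)"
proof -
  note [measurable] = bspline_one_measurable
  have "bspline_fibre (Suc (Suc n)) a b = (\<integral>\<^sup>+t. (\<integral>\<^sup>+q. ennreal (heis_bspline (Suc n) (heis_mult (a, b, t) (heis_inv q)))
      * ennreal (heis_bspline (Suc 0) q) \<partial>lborel) \<partial>lborel)"
    unfolding bspline_fibre_def bspline_Suc_nn_integral ..
  also have "\<dots> = (\<integral>\<^sup>+q. (\<integral>\<^sup>+t. ennreal (heis_bspline (Suc n) (heis_mult (a, b, t) (heis_inv q)))
      * ennreal (heis_bspline (Suc 0) q) \<partial>lborel) \<partial>lborel)"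
    by (rule lborel_pair.Fubini') measurable
  also have "\<dots> = (\<integral>\<^sup>+q. ennreal (heis_bspline (Suc 0) q) *
      bspline_fibre (Suc n) (a - fst q) (b - fst (snd q)) \<partial>lborel)"
  proof (rule nn_integral_cong)
    fix q :: heis
    obtain u v s where q: "q = (u, v, s)" by (cases q)
    have "heis_mult (a, b, t) (heis_inv q) = (a - u, b - v, t + (- s + (- (u * b) + v * a) / 2))" for t
      by (simp add: q)
    then have "(\<integral>\<^sup>+t. ennreal (heis_bspline (Suc n) (heis_mult (a, b, t) (heis_inv q)))
      * ennreal (heis_bspline (Suc 0) q) \<partial>lborel)
      = ennreal (heis_bspline (Suc 0) q) *
        (\<integral>\<^sup>+t. ennreal (heis_bspline (Suc n) (a - u, b - v, t + (- s + (- (u * b) + v * a) / 2))) \<partial>lborel)"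
      by (simp only: nn_integral_multc mult.commute[of _ "ennreal (heis_bspline (Suc 0) q)"])
        (rule nn_integral_cmult, measurable)
    also have "(\<integral>\<^sup>+t. ennreal (heis_bspline (Suc n) (a - u, b - v, t + (- s + (- (u * b) + v * a) / 2))) \<partial>lborel)
      = bspline_fibre (Suc n) (a - u) (b - v)"
      unfolding bspline_fibre_def
      by (rule nn_integral_real_shift[of "\<lambda>t. ennreal (heis_bspline (Suc n) (a - u, b - v, t))"]) measurable
    finally show "(\<integral>\<^sup>+t. ennreal (heis_bspline (Suc n) (heis_mult (a, b, t) (heis_inv q)))
      * ennreal (heis_bspline (Suc 0) q) \<partial>lborel)
      = ennreal (heis_bspline (Suc 0) q) * bspline_fibre (Suc n) (a - fst q) (b - fst (snd q))"
      by (simp add: q)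
  qed
  finally show ?thesis .
qed

section \<open>Tiling of the plane\<close>

lemma AE_heis_generic:
  fixes x y :: real
  shows "AE q::heis in lborel. (x - fst q) / 2 \<notin> \<int> \<and> y - fst (snd q) \<notin> \<int>"
proof -
  have c: "countable (\<int> :: real set)" by (simp add: Ints_def)
  \<comment> \<open>\<open>X\<close> and \<open>Y\<close> collect the first and second coordinates
    of \<open>q\<close> that put the shifted point \<open>(x - u, y - v)\<close> on a grid line of
    the tiling. Both are countable, so the cylinders over them in the nested product are
    null.\<close>
  define X where "X = (\<lambda>z. x - 2 * z) ` \<int>"
  define Y where "Y = (\<lambda>z. y - z) ` \<int>"
  have "countable X" "countable Y" by (simp_all only: X_def Y_def countable_image c)
  then have "X \<in> null_sets lborel" "Y \<in> null_sets lborel"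
    by (simp_all only: countable_imp_null_set_lborel)
  then have "X \<times> (UNIV :: (real \<times> real) set) \<in> null_sets (lborel \<Otimes>\<^sub>M lborel)"
    and "Y \<times> (UNIV :: real set) \<in> null_sets (lborel \<Otimes>\<^sub>M lborel)"
    by (auto intro!: lborel.times_in_null_sets1)
  then have 1: "X \<times> (UNIV :: (real \<times> real) set) \<in> null_sets lborel"
    and "Y \<times> (UNIV :: real set) \<in> null_sets lborel"
    by (simp_all add: lborel_prod)
  then have "(UNIV :: real set) \<times> (Y \<times> (UNIV :: real set)) \<in> null_sets (lborel \<Otimes>\<^sub>M lborel)"
    by (auto intro!: lborel.times_in_null_sets2)
  then have 2: "(UNIV :: real set) \<times> (Y \<times> (UNIV :: real set)) \<in> null_sets lborel"
    by (simp add: lborel_prod)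
  from AE_not_in[OF 1] AE_not_in[OF 2] show ?thesis
  proof eventually_elim
    case (elim q)
    have "(x - fst q) / 2 \<notin> \<int>"
    proof
      assume "(x - fst q) / 2 \<in> \<int>"
      then have "x - 2 * ((x - fst q) / 2) \<in> X" unfolding X_def by blast
      moreover have "x - 2 * ((x - fst q) / 2) = fst q" by (simp add: field_simps)
      ultimately have "fst q \<in> X" by (simp only:)
      with elim(1) show False by (cases q) simp
    qed
    moreover have "y - fst (snd q) \<notin> \<int>"
    proof
      assume "y - fst (snd q) \<in> \<int>"
      then have "y - (y - fst (snd q)) \<in> Y" unfolding Y_def by blast
      with elim(2) show False by (cases q) simp
    qed
    ultimately show ?case by blast
  qed
qed

text \<open>Induction on \<open>n\<close>: almost every point lies in exactly one tile, which gives
  the base value \<open>1 / sqrt 2\<close>, and each convolution with the first spline averages a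
  constant against mass \<open>sqrt 2\<close>. The tiles are closed, so at \<open>n = 0\<close> a
  point on a grid line is counted more than once and must be excluded; after one convolution such
  points form a null set under the integral.\<close>

lemma bspline_fibre_tiling:
  fixes x y :: real
  assumes "n = 0 \<Longrightarrow> x / 2 \<notin> \<int> \<and> y \<notin> \<int>"
  shows "(\<integral>\<^sup>+i. bspline_fibre (Suc n) (x - 2 * of_int (fst i)) (y - of_int (snd i))
      \<partial>count_space (UNIV :: (int \<times> int) set)) = ennreal (sqrt 2 powi (int n - 1))"
  using assms
proof (induction n arbitrary: x y)
  case 0
  then have ni: "x / 2 \<notin> \<int>" "y \<notin> \<int>" by auto
  have "(x - 2 * of_int k, y - of_int l) \<in> {0..2} \<times> {0..1} \<longleftrightarrow> (k, l) = (\<lfloor>x / 2\<rfloor>, \<lfloor>y\<rfloor>)" for k l :: int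
  proof -
    \<comment> \<open>Excluding the right and upper edges makes each closed tile behave as
      half-open, so the two floors give the only tile containing the point.\<close>
    have "x / 2 \<noteq> of_int (k + 1)" "y \<noteq> of_int (l + 1)" using ni by (metis Ints_of_int)+
    then have "x \<noteq> 2 * of_int k + 2" "y \<noteq> of_int l + 1" by auto
    then show ?thesis
      by (simp add: less_le floor_eq_iff[symmetric]) (simp add: eq_commute[of k] eq_commute[of l] floor_eq_iff, linarith)
  qed
  then have "bspline_fibre (Suc 0) (x - 2 * of_int (fst i)) (y - of_int (snd i))
      = ennreal (1 / sqrt 2) * indicator {(\<lfloor>x / 2\<rfloor>, \<lfloor>y\<rfloor>)} i" for i :: "int \<times> int"
    by (cases i) (auto simp: bspline_fibre_one indicator_def)
  then show ?case by (simp add: nn_integral_cmult power_int_minus inverse_eq_divide)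
next
  case (Suc n)
  note [measurable] = bspline_one_measurable
  have "(\<lambda>q::heis. fst q) \<in> borel_measurable borel" "(\<lambda>q::heis. fst (snd q)) \<in> borel_measurable borel"
    by (auto intro!: borel_measurable_continuous_onI continuous_intros)
  then have [measurable]: "(\<lambda>q::heis. fst q) \<in> borel_measurable lborel"
    "(\<lambda>q::heis. fst (snd q)) \<in> borel_measurable lborel" by simp_all
  have "(\<integral>\<^sup>+i. bspline_fibre (Suc (Suc n)) (x - 2 * of_int (fst i)) (y - of_int (snd i))
      \<partial>count_space (UNIV :: (int \<times> int) set))
    = (\<integral>\<^sup>+q. (\<integral>\<^sup>+i. ennreal (heis_bspline (Suc 0) q) * bspline_fibre (Suc n)
        (x - 2 * of_int (fst i) - fst q) (y - of_int (snd i) - fst (snd q))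
        \<partial>count_space (UNIV :: (int \<times> int) set)) \<partial>lborel)"
    unfolding bspline_fibre_Suc
  proof (rule nn_integral_count_space_nn_integral[symmetric])
    show "(\<lambda>q. ennreal (heis_bspline (Suc 0) q) * bspline_fibre (Suc n)
        (x - 2 * of_int (fst i) - fst q) (y - of_int (snd i) - fst (snd q)))
        \<in> borel_measurable lborel" for i :: "int \<times> int"
      by (intro borel_measurable_times_ennreal bspline_fibre_measurable borel_measurable_diff
          measurable_compose[OF _ measurable_ennreal]) simp_all
  qed simp
  also have "\<dots> = (\<integral>\<^sup>+q. ennreal (heis_bspline (Suc 0) q) * ennreal (sqrt 2 powi (int n - 1)) \<partial>lborel)"
  proof (rule nn_integral_cong_AE)
    \<comment> \<open>For almost every \<open>q\<close> the shifted point avoids the grid lines.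
      This supplies the premise of the induction hypothesis even at its base index.\<close>
    show "AE q in lborel. (\<integral>\<^sup>+i. ennreal (heis_bspline (Suc 0) q) * bspline_fibre (Suc n)
        (x - 2 * of_int (fst i) - fst q) (y - of_int (snd i) - fst (snd q))
        \<partial>count_space (UNIV :: (int \<times> int) set))
      = ennreal (heis_bspline (Suc 0) q) * ennreal (sqrt 2 powi (int n - 1))"
      using AE_heis_generic[of x y]
    proof eventually_elim
      case (elim q)
      have shift: "x - 2 * of_int (fst i) - fst q = x - fst q - 2 * of_int (fst i)"
        "y - of_int (snd i) - fst (snd q) = y - fst (snd q) - of_int (snd i)" for i :: "int \<times> int"
        by simp_all
      with elim show ?case
        using Suc.IH[of "x - fst q" "y - fst (snd q)"]
        by (simp add: nn_integral_cmult shift)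
    qed
  qed
  also have "\<dots> = ennreal (sqrt 2) * ennreal (sqrt 2 powi (int n - 1))"
    by (subst nn_integral_multc) (measurable, simp add: nn_integral_bspline_one)
  also have "\<dots> = ennreal (sqrt 2 powi (int (Suc n) - 1))"
    using power_int_add_1[of "sqrt 2" "int n - 1"]
    by (simp flip: ennreal_mult add: mult.commute)
  finally show ?case .
qed

text \<open>Summability is part of the claim because an infinite sum over a non-summable family is 0
  by convention. At \<open>n = 1\<close> the closed boxes overlap along grid lines, where the sum
  would at least double; hence the condition on \<open>x\<close> and \<open>y\<close>. The exponent
  there is -1, which \<open>powi\<close> accommodates.\<close>

theorem proposition3p4:
  fixes n :: nat and x y :: real
  assumes "n \<ge> 1"
    and "n = 1 \<Longrightarrow> x / 2 \<notin> \<int> \<and> y \<notin> \<int>"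
  shows "(\<forall>t\<in>{0..1}. (\<lambda>(k::int, l::int, m::int).
            heis_trans (2 * of_int k, of_int l, of_int m) (heis_bspline n) (x, y, t))
          summable_on UNIV) \<and>
         (LINT t:{0..1}|lborel. (\<Sum>\<^sub>\<infinity>(k::int, l::int, m::int)\<in>UNIV.
            heis_trans (2 * of_int k, of_int l, of_int m) (heis_bspline n) (x, y, t)))
          = sqrt 2 powi (int n - 2)"
proof -
  obtain N where n: "n = Suc N" using assms(1) by (cases n) auto
  define F where "F = (\<lambda>(k::int, l::int, m::int) t.
    heis_trans (2 * of_int k, of_int l, of_int m) (heis_bspline n) (x, y, t))"
  \<comment> \<open>The first lattice coordinate \<open>2 * k\<close> cancels the half in the group
    law for \<open>y\<close>; the resulting shear depends on neither \<open>t\<close> nor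
    \<open>m\<close>.\<close>
  have F: "F (k, l, m) t = heis_bspline (Suc N)
      (x - 2 * of_int k, y - of_int l, t + (y * of_int k - x * of_int l / 2) - of_int m)" for k l m t
    by (simp add: F_def heis_trans_def n algebra_simps diff_divide_distrib)
  have F_nonneg: "0 \<le> F i t" for i t by (cases i) (simp only: F bspline_nonneg)
  have F_meas [measurable]: "F i \<in> borel_measurable borel" for i
  proof -
    obtain k l m where i: "i = (k, l, m)" by (cases i)
    have "(\<lambda>t. F (k, l, m) t) \<in> borel_measurable borel" unfolding F by measurable
    then show ?thesis by (simp add: i)
  qed
  obtain R where R: "\<And>a b c. heis_bspline (Suc N) (a, b, c) \<noteq> 0 \<Longrightarrow>
      \<bar>a\<bar> \<le> R \<and> \<bar>b\<bar> \<le> R \<and> \<bar>c\<bar> \<le> R"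
    using bspline_support by blast
  \<comment> \<open>\<open>A\<close> bounds \<open>k\<close> and \<open>l\<close> through the planar
    support. Given \<open>t\<close> in the unit interval, the central support then bounds
    \<open>m\<close> by \<open>1 + R + \<bar>y\<bar> * A + \<bar>x\<bar> * A\<close>; the extra
    \<open>A\<close> in \<open>K\<close> lets one cube \<open>I\<close> contain all three
    indices.\<close>
  define A where "A = R + \<bar>x\<bar> + \<bar>y\<bar>"
  define K where "K = \<lceil>A + 1 + R + \<bar>y\<bar> * A + \<bar>x\<bar> * A\<rceil>"
  define I where "I = {-K..K} \<times> {-K..K} \<times> {-K..K}"
  have finI: "finite I" by (simp add: I_def)
  have supp: "i \<in> I" if t: "t \<in> {0..1}" and nz: "F i t \<noteq> 0" for i t
  proof -
    obtain k l m where i: "i = (k, l, m)" by (cases i)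
    from R[OF nz[unfolded i F]]
    have r: "\<bar>x - 2 * of_int k\<bar> \<le> R" "\<bar>y - of_int l\<bar> \<le> R"
      "\<bar>t + (y * of_int k - x * of_int l / 2) - of_int m\<bar> \<le> R" by auto
    have kl: "\<bar>of_int k :: real\<bar> \<le> A" "\<bar>of_int l :: real\<bar> \<le> A"
      using r by (auto simp: A_def)
    have yk: "\<bar>y * of_int k\<bar> \<le> \<bar>y\<bar> * A" "\<bar>x * of_int l\<bar> \<le> \<bar>x\<bar> * A"
      unfolding abs_mult by (intro mult_left_mono kl abs_ge_zero)+
    have "0 \<le> R" using r by linarith
    then have "A \<ge> 0" by (simp add: A_def)
    then have nn: "0 \<le> \<bar>y\<bar> * A" "0 \<le> \<bar>x\<bar> * A" by auto
    have B: "A + 1 + R + \<bar>y\<bar> * A + \<bar>x\<bar> * A \<le> of_int K" unfolding K_def by linarith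
    have "\<bar>of_int m :: real\<bar> \<le> 1 + R + \<bar>y\<bar> * A + \<bar>x\<bar> * A"
    proof -
      have "0 \<le> t" "t \<le> 1" using t by auto
      then show ?thesis using r(3) yk nn by linarith
    qed
    then have "\<bar>of_int k :: real\<bar> \<le> of_int K" "\<bar>of_int l :: real\<bar> \<le> of_int K" "\<bar>of_int m :: real\<bar> \<le> of_int K"
      using B kl nn \<open>0 \<le> R\<close> \<open>A \<ge> 0\<close> by linarith+
    then have "\<bar>k\<bar> \<le> K" "\<bar>l\<bar> \<le> K" "\<bar>m\<bar> \<le> K" by linarith+
    then show ?thesis by (auto simp: i I_def)
  qed
  have summ: "(\<lambda>i. F i t) summable_on UNIV" if "t \<in> {0..1}" for t
    using summable_on_cong_neutral[of I UNIV "\<lambda>i. F i t" "\<lambda>i. F i t"] supp[OF that] finI by auto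
  have infs: "(\<Sum>\<^sub>\<infinity>i. F i t) = (\<Sum>i\<in>I. F i t)" if "t \<in> {0..1}" for t
    using infsum_cong_neutral[of I UNIV "\<lambda>i. F i t" "\<lambda>i. F i t"] supp[OF that] finI by auto
  have "(LINT t:{0..1}|lborel. (\<Sum>\<^sub>\<infinity>i. F i t)) = (LINT t|lborel. indicator {0..1} t * (\<Sum>i\<in>I. F i t))"
    unfolding set_lebesgue_integral_def
    by (intro Bochner_Integration.integral_cong) (auto simp: indicator_def infs)
  also have "\<dots> = enn2real (\<integral>\<^sup>+t. ennreal (indicator {0..1} t * (\<Sum>i\<in>I. F i t)) \<partial>lborel)"
    by (intro integral_eq_nn_integral AE_I2 mult_nonneg_nonneg sum_nonneg F_nonneg) auto
  \<comment> \<open>The finite sum is expanded again to counting measure on the whole lattice. The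
    index set becomes a full product, so Tonelli can interchange sum and integral and split the
    sum.\<close>
  also have "(\<integral>\<^sup>+t. ennreal (indicator {0..1} t * (\<Sum>i\<in>I. F i t)) \<partial>lborel)
      = (\<integral>\<^sup>+t. (\<integral>\<^sup>+i. ennreal (F i t) * indicator {0..1} t \<partial>count_space UNIV) \<partial>lborel)"
  proof (rule nn_integral_cong)
    fix t :: real
    show "ennreal (indicator {0..1} t * (\<Sum>i\<in>I. F i t))
        = (\<integral>\<^sup>+i. ennreal (F i t) * indicator {0..1} t \<partial>count_space UNIV)"
    proof (cases "t \<in> {0..1}")
      case True
      have "(\<integral>\<^sup>+i. ennreal (F i t) \<partial>count_space UNIV) = (\<Sum>i\<in>I. ennreal (F i t))"
        using finI supp[OF True] by (intro nn_integral_count_space') (auto, metis ennreal_0)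
      with True show ?thesis by (simp add: F_nonneg)
    qed simp
  qed
  also have "\<dots> = (\<integral>\<^sup>+i. (\<integral>\<^sup>+t. ennreal (F i t) * indicator {0..1} t \<partial>lborel) \<partial>count_space UNIV)"
    by (rule nn_integral_count_space_nn_integral) auto
  also have "\<dots> = (\<integral>\<^sup>+k. \<integral>\<^sup>+l. \<integral>\<^sup>+m. (\<integral>\<^sup>+t. ennreal (F (k, l, m) t) * indicator {0..1} t \<partial>lborel)
      \<partial>count_space UNIV \<partial>count_space UNIV \<partial>count_space UNIV)"
    by (simp only: nn_integral_count_space_prod)
  also have "\<dots> = (\<integral>\<^sup>+k. \<integral>\<^sup>+l. bspline_fibre (Suc N) (x - 2 * of_int k) (y - of_int l)
      \<partial>count_space UNIV \<partial>count_space UNIV)"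
  proof (intro nn_integral_cong)
    fix k l :: int
    let ?c = "y * of_int k - x * of_int l / 2"
    \<comment> \<open>The argument is regrouped as a fixed function of \<open>t - m\<close>, the
      form that periodization needs. The remaining constant \<open>?c\<close> disappears once the
      integral runs over the whole line.\<close>
    have F': "F (k, l, m) t = heis_bspline (Suc N) (x - 2 * of_int k, y - of_int l, t - of_int m + ?c)" for m t
      unfolding F by (rule arg_cong[where f = "heis_bspline (Suc N)"]) simp
    have "(\<integral>\<^sup>+m. (\<integral>\<^sup>+t. ennreal (F (k, l, m) t) * indicator {0..1} t \<partial>lborel) \<partial>count_space UNIV)
      = (\<integral>\<^sup>+t. ennreal (heis_bspline (Suc N) (x - 2 * of_int k, y - of_int l, t + ?c)) \<partial>lborel)"
      unfolding F'
      by (rule nn_integral_periodization[of "\<lambda>t. ennreal (heis_bspline (Suc N) (x - 2 * of_int k, y - of_int l, t + ?c))"])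
        measurable
    also have "\<dots> = bspline_fibre (Suc N) (x - 2 * of_int k) (y - of_int l)"
      unfolding bspline_fibre_def
      by (rule nn_integral_real_shift[of "\<lambda>t. ennreal (heis_bspline (Suc N) (x - 2 * of_int k, y - of_int l, t))"]) measurable
    finally show "(\<integral>\<^sup>+m. (\<integral>\<^sup>+t. ennreal (F (k, l, m) t) * indicator {0..1} t \<partial>lborel) \<partial>count_space UNIV)
      = bspline_fibre (Suc N) (x - 2 * of_int k) (y - of_int l)" .
  qed
  also have "\<dots> = (\<integral>\<^sup>+i. bspline_fibre (Suc N) (x - 2 * of_int (fst i)) (y - of_int (snd i))
      \<partial>count_space (UNIV :: (int \<times> int) set))"
    by (simp only: nn_integral_count_space_prod fst_conv snd_conv)
  \<comment> \<open>Since \<open>n = Suc N\<close>, the exponent \<open>int N - 1\<close> is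
    \<open>int n - 2\<close>.\<close>
  also have "\<dots> = ennreal (sqrt 2 powi (int N - 1))"
    using assms(2) by (intro bspline_fibre_tiling) (simp add: n)
  finally have "(LINT t:{0..1}|lborel. (\<Sum>\<^sub>\<infinity>i. F i t)) = sqrt 2 powi (int n - 2)"
    by (simp add: n)
  moreover have "(\<lambda>i. F i t) = (\<lambda>(k, l, m).
      heis_trans (2 * of_int k, of_int l, of_int m) (heis_bspline n) (x, y, t))" for t
    by (auto simp only: F_def fun_eq_iff split_paired_all prod.case)
  ultimately show ?thesis using summ by simp
qed

end
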